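(* Let $C=(\varphi,\Phi)$ be a skew-evolution semiflow on $Y=X\times V$ with uniform exponential growth. Then $C$ is uniformly exponentially stable if and only if there exist a function $R\in\mathcal{R}$ and a constant $\widetilde{M}\geq 1$ such that $$\sum_{n=[t_{0}]+1}^{\infty}R\left(\Vert\Phi(n,t_{0},x)v\Vert\right)\leq\widetilde{M}\,R\left(\Vert v\Vert\right)$$ for all $(x,v)\in Y$ and all real $t_{0}\geq 0$, where $[t_{0}]$ denotes the integer part of $t_{0}$.
   Context: $(X,d)$ is a metric space, $V$ a Banach space, $\mathcal{B}(V)$ the space of bounded linear operators on $V$, $I$ the identity on $V$, $Y=X\times V$, $\mathbb{R}_{+}=[0,\infty)$, $T=\{(t,t_{0})\in\mathbb{R}_{+}^{2}: t\geq t_{0}\}$. Norms on $V$ and $\mathcal{B}(V)$ are denoted $\Vert\cdot\Vert$. $\mathcal{R}$ is the set of nondecreasing functions $R:\mathbb{R}_{+}\to\mathbb{R}_{+}$ with $R(0)=0$ and $R(t)>0$ for all $t>0$. An evolution semiflow on $X$ is a mapping $\varphi:T\times X\to X$ with $\varphi(t,t,x)=x$ for all $(t,x)\in\mathbb{R}_{+}\times X$ and $\varphi(t,s,\varphi(s,t_{0},x))=\varphi(t,t_{0},x)$ for all $(t,s),(s,t_{0})\in T$, $x\in X$. An evolution cocycle over $\varphi$ is a mapping $\Phi:T\times X\to\mathcal{B}(V)$ with $\Phi(t,t,x)=I$ for all $t\geq 0$, $x\in X$ and $\Phi(t,s,\varphi(s,t_{0},x))\Phi(s,t_{0},x)=\Phi(t,t_{0},x)$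 for all $(t,s),(s,t_{0})\in T$, $x\in X$. The mapping $C:T\times Y\to Y$, $C(t,s,x,v)=(\varphi(t,s,x),\Phi(t,s,x)v)$, is then called a skew-evolution semiflow on $Y$, written $C=(\varphi,\Phi)$. $C$ has uniform exponential growth if there exist constants $M\geq 1$, $\omega>0$ with $\Vert\Phi(t,t_{0},x)v\Vert\leq Me^{\omega(t-s)}\Vert\Phi(s,t_{0},x)v\Vert$ for all $(t,s),(s,t_{0})\in T$ and all $(x,v)\in Y$. $C$ is uniformly exponentially stable if there exist constants $N\geq 1$, $\nu>0$ with $\Vert\Phi(t,t_{0},x)v\Vert\leq Ne^{-\nu(t-s)}\Vert\Phi(s,t_{0},x)v\Vert$ for all $(t,s),(s,t_{0})\in T$ and all $(x,v)\in Y$. *)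

theory Defs
  imports "HOL-Analysis.Analysis"
begin

definition T_set :: "(real \<times> real) set" where
  "T_set = {(t, t\<^sub>0). 0 \<le> t \<and> 0 \<le> t\<^sub>0 \<and> t\<^sub>0 \<le> t}"

definition R_class :: "(real \<Rightarrow> real) set" where
  "R_class = {R. R ` {0..} \<subseteq> {0..} \<and> mono_on {0..} R \<and> R 0 = 0 \<and> (\<forall>t>0. 0 < R t)}"

text \<open>
  Mappings with domain $T \times X$ or $T \times Y$ are total curried functions; every condition
  below constrains only their values at times in \<^const>\<open>T_set\<close>.
\<close>

definition evolution_semiflow :: "(real \<Rightarrow> real \<Rightarrow> 'x::metric_space \<Rightarrow> 'x) \<Rightarrow> bool" where
  "evolution_semiflow \<phi> \<longleftrightarrow>
     (\<forall>t\<ge>0. \<forall>x. \<phi> t t x = x) \<and>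
     (\<forall>t s t\<^sub>0 x. (t, s) \<in> T_set \<longrightarrow> (s, t\<^sub>0) \<in> T_set \<longrightarrow> \<phi> t s (\<phi> s t\<^sub>0 x) = \<phi> t t\<^sub>0 x)"

definition evolution_cocycle ::
  "(real \<Rightarrow> real \<Rightarrow> 'x::metric_space \<Rightarrow> 'x) \<Rightarrow> (real \<Rightarrow> real \<Rightarrow> 'x \<Rightarrow> 'v::banach \<Rightarrow>\<^sub>L 'v) \<Rightarrow> bool"
where
  "evolution_cocycle \<phi> \<Phi> \<longleftrightarrow>
     (\<forall>t\<ge>0. \<forall>x. \<Phi> t t x = id_blinfun) \<and>
     (\<forall>t s t\<^sub>0 x. (t, s) \<in> T_set \<longrightarrow> (s, t\<^sub>0) \<in> T_set \<longrightarrow>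
        \<Phi> t s (\<phi> s t\<^sub>0 x) o\<^sub>L \<Phi> s t\<^sub>0 x = \<Phi> t t\<^sub>0 x)"

definition skew_evolution_semiflow ::
  "(real \<Rightarrow> real \<Rightarrow> 'x::metric_space \<Rightarrow> 'x) \<Rightarrow> (real \<Rightarrow> real \<Rightarrow> 'x \<Rightarrow> 'v::banach \<Rightarrow>\<^sub>L 'v) \<Rightarrow>
   (real \<Rightarrow> real \<Rightarrow> 'x \<times> 'v \<Rightarrow> 'x \<times> 'v) \<Rightarrow> bool"
where
  "skew_evolution_semiflow \<phi> \<Phi> C \<longleftrightarrow>
     evolution_semiflow \<phi> \<and> evolution_cocycle \<phi> \<Phi> \<and>
     (\<forall>t s x v. (t, s) \<in> T_set \<longrightarrow> C t s (x, v) = (\<phi> t s x, blinfun_apply (\<Phi> t s x) v))"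

text \<open>
  Growth and stability of $C = (\varphi, \Phi)$ involve the cocycle $\Phi$ only, so the two
  predicates take $\Phi$ as their argument.
\<close>

definition uniform_exponential_growth ::
  "(real \<Rightarrow> real \<Rightarrow> 'x::metric_space \<Rightarrow> 'v::banach \<Rightarrow>\<^sub>L 'v) \<Rightarrow> bool" where
  "uniform_exponential_growth \<Phi> \<longleftrightarrow>
     (\<exists>M \<omega>. M \<ge> 1 \<and> \<omega> > 0 \<and>
        (\<forall>t s t\<^sub>0 x v. (t, s) \<in> T_set \<longrightarrow> (s, t\<^sub>0) \<in> T_set \<longrightarrow>
           norm (\<Phi> t t\<^sub>0 x v) \<le> M * exp (\<omega> * (t - s)) * norm (\<Phi> s t\<^sub>0 x v)))"

definition uniformly_exponentially_stable ::
  "(real \<Rightarrow> real \<Rightarrow> 'x::metric_space \<Rightarrow> 'v::banach \<Rightarrow>\<^sub>L 'v) \<Rightarrow> bool" where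
  "uniformly_exponentially_stable \<Phi> \<longleftrightarrow>
     (\<exists>N \<nu>. N \<ge> 1 \<and> \<nu> > 0 \<and>
        (\<forall>t s t\<^sub>0 x v. (t, s) \<in> T_set \<longrightarrow> (s, t\<^sub>0) \<in> T_set \<longrightarrow>
           norm (\<Phi> t t\<^sub>0 x v) \<le> N * exp (- \<nu> * (t - s)) * norm (\<Phi> s t\<^sub>0 x v)))"

end

theory Submission imports Defs begin

text \<open>
  Stability gives the summability condition with $R(t) = t$, by comparison with a geometric series.

  For the converse, the condition is applied not only at $t_0$ but again at every later integer
  time, along the orbit. The first application bounds the sum of the values $R(\|\Phi(n,t_0,x)v\|)$,
  the later ones show that each of these values controls all the following ones up to the factor
  $M$. Hence the $K$-th value is at most $M^2 R(\|v\|) / K$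
  (\<open>late_value_times_index_le\<close>).

  The function $R$ may grow or decay arbitrarily fast, so a small value of $R$ does not in itself
  say how small its argument is relative to $\|v\|$. Linearity settles this: $v$ can be rescaled
  to norm $1$, and then only the two positive numbers $R(1)$ and $R(c)$ matter. As soon as
  $M^2 R(1) / K < R(c)$, the vector of index $K$ has norm at most $c \|v\|$
  (\<open>contraction_at_integer_times\<close>). Exponential growth turns this into a contraction
  over one fixed time step, uniform in the starting time and point, and iterating the contraction
  gives the exponential rate (\<open>stable_if_contracting_step\<close>).
\<close>

section \<open>The cocycle acting on vectors\<close>

lemma cocycle_compose_apply:
  assumes "evolution_cocycle \<phi> \<Phi>" "0 \<le> t\<^sub>0" "t\<^sub>0 \<le> s" "s \<le> t"
  shows "\<Phi> t s (\<phi> s t\<^sub>0 x) (\<Phi> s t\<^sub>0 x v) = \<Phi> t t\<^sub>0 x v"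
proof -
  have "\<Phi> t s (\<phi> s t\<^sub>0 x) o\<^sub>L \<Phi> s t\<^sub>0 x = \<Phi> t t\<^sub>0 x"
    using assms unfolding evolution_cocycle_def T_set_def by auto
  then show ?thesis
    by (metis blinfun_apply_blinfun_compose)
qed

lemma cocycle_self_apply:
  assumes "evolution_cocycle \<phi> \<Phi>" "0 \<le> t"
  shows "\<Phi> t t x v = v"
  using assms unfolding evolution_cocycle_def by simp

section \<open>From stability to summability\<close>

lemma has_sum_geometric_from:
  fixes q :: real
  assumes "0 \<le> q" "q < 1"
  shows "((\<lambda>n. q ^ (n - m)) has_sum 1 / (1 - q)) {m..}"
proof -
  have "((\<lambda>k. q ^ k) has_sum 1 / (1 - q)) UNIV"
    using assms by (intro sums_nonneg_imp_has_sum geometric_sums) auto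
  moreover have "bij_betw (\<lambda>k. m + k) UNIV {m..}"
    by (rule bij_betw_byWitness[where f' = "\<lambda>n. n - m"]) auto
  ultimately show ?thesis
    using has_sum_reindex_bij_betw[of "\<lambda>k. m + k" UNIV "{m..}" "\<lambda>n. q ^ (n - m)"] by simp
qed

lemma stable_imp_summable_norm:
  fixes \<Phi> :: "real \<Rightarrow> real \<Rightarrow> 'x::metric_space \<Rightarrow> 'v::banach \<Rightarrow>\<^sub>L 'v"
  assumes coc: "evolution_cocycle \<phi> \<Phi>" and stable: "uniformly_exponentially_stable \<Phi>"
  obtains M where "M \<ge> 1"
    and "\<And>x v t\<^sub>0. 0 \<le> t\<^sub>0 \<Longrightarrow>
      (\<lambda>n. norm (\<Phi> (real n) t\<^sub>0 x v)) summable_on {nat \<lfloor>t\<^sub>0\<rfloor> + 1..} \<and>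
      (\<Sum>\<^sub>\<infinity>n\<in>{nat \<lfloor>t\<^sub>0\<rfloor> + 1..}. norm (\<Phi> (real n) t\<^sub>0 x v)) \<le> M * norm v"
proof -
  obtain N \<nu> where N: "N \<ge> 1" and \<nu>: "\<nu> > 0"
    and decay: "\<And>t s t\<^sub>0 x v. 0 \<le> t\<^sub>0 \<Longrightarrow> t\<^sub>0 \<le> s \<Longrightarrow> s \<le> t \<Longrightarrow>
      norm (\<Phi> t t\<^sub>0 x v) \<le> N * exp (- \<nu> * (t - s)) * norm (\<Phi> s t\<^sub>0 x v)"
    using stable unfolding uniformly_exponentially_stable_def T_set_def by auto
  define q where "q = exp (- \<nu>)"
  have q: "0 < q" "q < 1"
    using \<nu> by (auto simp: q_def)
  show thesis
  proof
    show "N / (1 - q) \<ge> 1"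
      using N q by (simp add: field_simps)
    fix x v and t\<^sub>0 :: real
    assume t0: "0 \<le> t\<^sub>0"
    define m where "m = nat \<lfloor>t\<^sub>0\<rfloor> + 1"
    have m: "t\<^sub>0 \<le> real m"
      using t0 unfolding m_def by linarith
    have dom: "norm (\<Phi> (real n) t\<^sub>0 x v) \<le> N * norm v * q ^ (n - m)" if "n \<in> {m..}" for n
    proof -
      have le: "real (n - m) \<le> real n - t\<^sub>0"
        using that m by simp
      have "norm (\<Phi> (real n) t\<^sub>0 x v) \<le> N * exp (- \<nu> * (real n - t\<^sub>0)) * norm v"
        using decay[of t\<^sub>0 t\<^sub>0 "real n" x v] cocycle_self_apply[OF coc t0, of x v] t0 m that by auto
      also have "\<dots> \<le> N * exp (- \<nu> * real (n - m)) * norm v"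
        using le N \<nu> by (intro mult_right_mono mult_left_mono) auto
      also have "exp (- \<nu> * real (n - m)) = q ^ (n - m)"
        unfolding q_def by (metis exp_of_nat_mult mult.commute)
      finally show ?thesis
        by (simp add: mult_ac)
    qed
    have geo: "((\<lambda>n. N * norm v * q ^ (n - m)) has_sum N * norm v * (1 / (1 - q))) {m..}"
      using q by (intro has_sum_cmult_right has_sum_geometric_from) auto
    have summ: "(\<lambda>n. norm (\<Phi> (real n) t\<^sub>0 x v)) summable_on {m..}"
      by (rule summable_on_comparison_test[OF has_sum_imp_summable[OF geo]]) (use dom in auto)
    have "(\<Sum>\<^sub>\<infinity>n\<in>{m..}. norm (\<Phi> (real n) t\<^sub>0 x v)) \<le> (\<Sum>\<^sub>\<infinity>n\<in>{m..}. N * norm v * q ^ (n - m))"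
      by (rule infsum_mono[OF summ has_sum_imp_summable[OF geo]]) (use dom in auto)
    also have "\<dots> = N / (1 - q) * norm v"
      using infsumI[OF geo] by simp
    finally show "(\<lambda>n. norm (\<Phi> (real n) t\<^sub>0 x v)) summable_on {nat \<lfloor>t\<^sub>0\<rfloor> + 1..} \<and>
      (\<Sum>\<^sub>\<infinity>n\<in>{nat \<lfloor>t\<^sub>0\<rfloor> + 1..}. norm (\<Phi> (real n) t\<^sub>0 x v)) \<le> N / (1 - q) * norm v"
      using summ unfolding m_def by simp
  qed
qed

section \<open>From summability to a contraction\<close>

definition summability_bound ::
  "(real \<Rightarrow> real) \<Rightarrow> real \<Rightarrow> (real \<Rightarrow> real \<Rightarrow> 'x::metric_space \<Rightarrow> 'v::banach \<Rightarrow>\<^sub>L 'v) \<Rightarrow> bool"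
where
  "summability_bound R M \<Phi> \<longleftrightarrow>
     (\<forall>x v. \<forall>t\<^sub>0\<ge>0.
        (\<lambda>n. R (norm (\<Phi> (real n) t\<^sub>0 x v))) summable_on {nat \<lfloor>t\<^sub>0\<rfloor> + 1..} \<and>
        (\<Sum>\<^sub>\<infinity>n\<in>{nat \<lfloor>t\<^sub>0\<rfloor> + 1..}. R (norm (\<Phi> (real n) t\<^sub>0 x v))) \<le> M * R (norm v))"

lemma R_class_nonneg:
  assumes "R \<in> R_class" "0 \<le> r"
  shows "0 \<le> R r"
  using assms by (simp add: R_class_def image_subset_iff)

lemma R_class_pos:
  assumes "R \<in> R_class" "0 < r"
  shows "0 < R r"
  using assms by (simp add: R_class_def)

lemma R_class_mono:
  assumes "R \<in> R_class" "0 \<le> r" "r \<le> s"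
  shows "R r \<le> R s"
proof -
  have "mono_on {0..} R"
    using assms(1) by (simp add: R_class_def)
  then show ?thesis
    by (rule mono_onD) (use assms in auto)
qed

lemma partial_sum_le:
  assumes R: "R \<in> R_class" and bound: "summability_bound R M \<Phi>" and t0: "0 \<le> t\<^sub>0"
    and F: "finite F" "F \<subseteq> {nat \<lfloor>t\<^sub>0\<rfloor> + 1..}"
  shows "(\<Sum>n\<in>F. R (norm (\<Phi> (real n) t\<^sub>0 x v))) \<le> M * R (norm v)"
proof -
  have total: "(\<lambda>n. R (norm (\<Phi> (real n) t\<^sub>0 x v))) summable_on {nat \<lfloor>t\<^sub>0\<rfloor> + 1..}"
    "(\<Sum>\<^sub>\<infinity>n\<in>{nat \<lfloor>t\<^sub>0\<rfloor> + 1..}. R (norm (\<Phi> (real n) t\<^sub>0 x v))) \<le> M * R (norm v)"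
    using bound[unfolded summability_bound_def, rule_format, OF t0] by simp_all
  have "(\<Sum>n\<in>F. R (norm (\<Phi> (real n) t\<^sub>0 x v)))
      \<le> (\<Sum>\<^sub>\<infinity>n\<in>{nat \<lfloor>t\<^sub>0\<rfloor> + 1..}. R (norm (\<Phi> (real n) t\<^sub>0 x v)))"
    by (rule finite_sum_le_infsum[OF total(1) F]) (simp add: R_class_nonneg[OF R])
  also have "\<dots> \<le> M * R (norm v)"
    by (rule total(2))
  finally show ?thesis .
qed

text \<open>
  The $K$ values at the integers $[t_0]+1, \ldots, [t_0]+K$ have sum at most $M R(\|v\|)$, and each
  of them is at least $1/M$ times the last one, by the same condition started at that integer.
\<close>

lemma late_value_times_index_le:
  fixes \<Phi> :: "real \<Rightarrow> real \<Rightarrow> 'x::metric_space \<Rightarrow> 'v::banach \<Rightarrow>\<^sub>L 'v"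
  assumes coc: "evolution_cocycle \<phi> \<Phi>" and R: "R \<in> R_class" and M: "M \<ge> 1"
    and bound: "summability_bound R M \<Phi>" and t0: "0 \<le> t\<^sub>0"
  shows "real K * R (norm (\<Phi> (real (nat \<lfloor>t\<^sub>0\<rfloor> + K)) t\<^sub>0 x v)) \<le> M\<^sup>2 * R (norm v)"
proof -
  define m where "m = nat \<lfloor>t\<^sub>0\<rfloor>"
  define a where "a n = R (norm (\<Phi> (real n) t\<^sub>0 x v))" for n
  have nonneg: "0 \<le> a n" for n
    using R_class_nonneg[OF R] by (simp add: a_def)
  have last: "a (m + K) \<le> M * a n" if n: "n \<in> {m+1..m+K}" for n
  proof (cases "n = m + K")
    case True
    then show ?thesis
      using mult_right_mono[OF M nonneg[of n]] by simp
  next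
    case False
    have "m < n"
      using n by simp
    then have t0n: "t\<^sub>0 \<le> real n"
      using t0 unfolding m_def by linarith
    have "R (norm (\<Phi> (real (m + K)) (real n) (\<phi> (real n) t\<^sub>0 x) (\<Phi> (real n) t\<^sub>0 x v)))
        \<le> M * R (norm (\<Phi> (real n) t\<^sub>0 x v))"
      using partial_sum_le[OF R bound, of "real n" "{m + K}" "\<phi> (real n) t\<^sub>0 x" "\<Phi> (real n) t\<^sub>0 x v"]
        False n by simp
    then show ?thesis
      using cocycle_compose_apply[OF coc t0 t0n, of "real (m + K)" x v] n by (simp add: a_def)
  qed
  have "real K * a (m + K) = (\<Sum>n\<in>{m+1..m+K}. a (m + K))"
    by simp
  also have "\<dots> \<le> (\<Sum>n\<in>{m+1..m+K}. M * a n)"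
    by (rule sum_mono) (rule last)
  also have "\<dots> = M * (\<Sum>n\<in>{m+1..m+K}. a n)"
    by (simp add: sum_distrib_left)
  also have "\<dots> \<le> M * (M * R (norm v))"
    using M partial_sum_le[OF R bound t0, of "{m+1..m+K}" x v]
    by (intro mult_left_mono) (simp_all add: a_def m_def)
  finally show ?thesis
    by (simp add: a_def m_def power2_eq_square mult_ac)
qed

text \<open>
  The index $K$ is uniform because, after normalising $v$, only $R(1)$ and $R(c) > 0$ enter:
  monotonicity turns $R(\|\Phi v\|) < R(c)$ into $\|\Phi v\| < c$.
\<close>

lemma contraction_at_integer_times:
  fixes \<Phi> :: "real \<Rightarrow> real \<Rightarrow> 'x::metric_space \<Rightarrow> 'v::banach \<Rightarrow>\<^sub>L 'v"
  assumes coc: "evolution_cocycle \<phi> \<Phi>" and R: "R \<in> R_class" and M: "M \<ge> 1"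
    and bound: "summability_bound R M \<Phi>" and c: "0 < c"
  obtains K where "K \<ge> 1"
    and "\<And>x v t\<^sub>0. 0 \<le> t\<^sub>0 \<Longrightarrow> norm (\<Phi> (real (nat \<lfloor>t\<^sub>0\<rfloor> + K)) t\<^sub>0 x v) \<le> c * norm v"
proof -
  have Rc: "0 < R c"
    using R c by (rule R_class_pos)
  obtain K where K: "M\<^sup>2 * R 1 / R c < real K"
    using reals_Archimedean2 by blast
  have "0 < R 1"
    using R_class_pos[OF R] by simp
  then have "0 \<le> M\<^sup>2 * R 1 / R c"
    using Rc by simp
  then have Kpos: "K \<ge> 1"
    using K by linarith
  have "norm (\<Phi> (real (nat \<lfloor>t\<^sub>0\<rfloor> + K)) t\<^sub>0 x v) \<le> c * norm v" if t0: "0 \<le> t\<^sub>0" for t\<^sub>0 x v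
  proof (cases "v = 0")
    case False
    define u where "u = v /\<^sub>R norm v"
    define A where "A = \<Phi> (real (nat \<lfloor>t\<^sub>0\<rfloor> + K)) t\<^sub>0 x"
    have "norm u = 1"
      using False by (simp add: u_def)
    then have "real K * R (norm (A u)) \<le> M\<^sup>2 * R 1"
      using late_value_times_index_le[OF coc R M bound t0, of K x u] by (simp add: A_def)
    also have "\<dots> < real K * R c"
      using K Rc by (simp add: field_simps)
    finally have "R (norm (A u)) < R c"
      using Kpos by simp
    moreover have "R c \<le> R (norm (A u))" if "c \<le> norm (A u)"
      using R_class_mono[OF R] c that by simp
    ultimately have "norm (A u) \<le> c"
      by linarith
    moreover have "norm (A v) = norm v * norm (A u)"
      using False by (simp add: u_def blinfun.scaleR_right)
    ultimately show ?thesis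
      unfolding A_def by (metis mult.commute mult_left_mono norm_ge_zero)
  qed (simp add: blinfun.zero_right)
  with Kpos show thesis
    using that by blast
qed

section \<open>From a contraction to stability\<close>

text \<open>
  Over $j$ steps of length $\tau$ the norm shrinks by $e^{-j}$, which gives the rate $1/\tau$; the
  growth bound covers the remaining time of less than $\tau$. Stability compares two times
  $s \leq t$ on one orbit, which is the comparison of $t$ with the starting time for the orbit
  restarted at time $s$.
\<close>

lemma stable_if_contracting_step:
  fixes \<Phi> :: "real \<Rightarrow> real \<Rightarrow> 'x::metric_space \<Rightarrow> 'v::banach \<Rightarrow>\<^sub>L 'v"
  assumes coc: "evolution_cocycle \<phi> \<Phi>" and growth: "uniform_exponential_growth \<Phi>"
    and \<tau>: "\<tau> > 0"
    and step: "\<And>t\<^sub>0 x v. 0 \<le> t\<^sub>0 \<Longrightarrow> norm (\<Phi> (t\<^sub>0 + \<tau>) t\<^sub>0 x v) \<le> exp (-1) * norm v"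
  shows "uniformly_exponentially_stable \<Phi>"
proof -
  obtain G \<omega> where G: "G \<ge> 1" and \<omega>: "\<omega> > 0"
    and grow: "\<And>t s t\<^sub>0 x v. 0 \<le> t\<^sub>0 \<Longrightarrow> t\<^sub>0 \<le> s \<Longrightarrow> s \<le> t \<Longrightarrow>
      norm (\<Phi> t t\<^sub>0 x v) \<le> G * exp (\<omega> * (t - s)) * norm (\<Phi> s t\<^sub>0 x v)"
    using growth unfolding uniform_exponential_growth_def T_set_def by auto
  have steps: "norm (\<Phi> (s + real j * \<tau>) s x v) \<le> exp (- real j) * norm v"
    if s: "0 \<le> s" for s x v j
  proof (induction j)
    case 0
    show ?case
      using cocycle_self_apply[OF coc s, of x v] by simp
  next
    case (Suc j)
    define r where "r = s + real j * \<tau>"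
    have r: "s \<le> r"
      using \<tau> by (simp add: r_def)
    have "norm (\<Phi> (r + \<tau>) s x v) \<le> exp (-1) * norm (\<Phi> r s x v)"
      using step[of r "\<phi> r s x" "\<Phi> r s x v"] cocycle_compose_apply[OF coc s r, of "r + \<tau>" x v] s r \<tau>
      by simp
    also have "\<dots> \<le> exp (-1) * (exp (- real j) * norm v)"
      using Suc unfolding r_def by (rule mult_left_mono) simp
    also have "\<dots> = exp (- real (Suc j)) * norm v"
      by (simp add: mult_exp_exp flip: mult.assoc)
    also have "r + \<tau> = s + real (Suc j) * \<tau>"
      by (simp add: r_def algebra_simps)
    finally show ?case .
  qed
  define N where "N = G * exp (\<omega> * \<tau>) * exp 1"
  have from_start: "norm (\<Phi> t s x v) \<le> N * exp (- (1 / \<tau>) * (t - s)) * norm v"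
    if s: "0 \<le> s" and st: "s \<le> t" for s t x v
  proof -
    define j where "j = nat \<lfloor>(t - s) / \<tau>\<rfloor>"
    have "0 \<le> (t - s) / \<tau>"
      using st \<tau> by simp
    then have j: "real j \<le> (t - s) / \<tau>" "(t - s) / \<tau> \<le> real j + 1"
      unfolding j_def by linarith+
    define r where "r = s + real j * \<tau>"
    have r: "s \<le> r" "r \<le> t" "t - r \<le> \<tau>"
      using j \<tau> by (auto simp: r_def field_simps)
    have "norm (\<Phi> t s x v) \<le> G * exp (\<omega> * (t - r)) * norm (\<Phi> r s x v)"
      using grow s r by blast
    also have "\<dots> \<le> G * exp (\<omega> * \<tau>) * (exp (1 - (t - s) / \<tau>) * norm v)"
    proof (rule mult_mono)
      show "G * exp (\<omega> * (t - r)) \<le> G * exp (\<omega> * \<tau>)"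
        using G \<omega> r by simp
      have "norm (\<Phi> r s x v) \<le> exp (- real j) * norm v"
        using steps[OF s] unfolding r_def .
      also have "\<dots> \<le> exp (1 - (t - s) / \<tau>) * norm v"
        using j by (intro mult_right_mono) auto
      finally show "norm (\<Phi> r s x v) \<le> exp (1 - (t - s) / \<tau>) * norm v" .
    qed (use G in auto)
    also have "\<dots> = N * exp (- (1 / \<tau>) * (t - s)) * norm v"
      by (simp add: N_def exp_diff exp_minus field_simps)
    finally show ?thesis .
  qed
  have "norm (\<Phi> t t\<^sub>0 x v) \<le> N * exp (- (1 / \<tau>) * (t - s)) * norm (\<Phi> s t\<^sub>0 x v)"
    if "0 \<le> t\<^sub>0" "t\<^sub>0 \<le> s" "s \<le> t" for t s t\<^sub>0 x v
    using from_start[of s t "\<phi> s t\<^sub>0 x" "\<Phi> s t\<^sub>0 x v"] cocycle_compose_apply[OF coc that, of x v] that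
    by simp
  moreover have "N \<ge> 1"
  proof -
    have "1 * 1 \<le> G * exp (\<omega> * \<tau>)"
      using G \<omega> \<tau> by (intro mult_mono) auto
    then have "1 * 1 \<le> G * exp (\<omega> * \<tau>) * exp 1"
      by (intro mult_mono) auto
    then show ?thesis
      by (simp add: N_def)
  qed
  ultimately show ?thesis
    using \<tau> unfolding uniformly_exponentially_stable_def T_set_def
    by (intro exI[of _ N] exI[of _ "1 / \<tau>"]) auto
qed

lemma stable_if_summable:
  fixes \<Phi> :: "real \<Rightarrow> real \<Rightarrow> 'x::metric_space \<Rightarrow> 'v::banach \<Rightarrow>\<^sub>L 'v"
  assumes coc: "evolution_cocycle \<phi> \<Phi>" and growth: "uniform_exponential_growth \<Phi>"
    and R: "R \<in> R_class" and M: "M \<ge> 1" and bound: "summability_bound R M \<Phi>"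
  shows "uniformly_exponentially_stable \<Phi>"
proof -
  obtain G \<omega> where G: "G \<ge> 1" and \<omega>: "\<omega> > 0"
    and grow: "\<And>t s t\<^sub>0 x v. 0 \<le> t\<^sub>0 \<Longrightarrow> t\<^sub>0 \<le> s \<Longrightarrow> s \<le> t \<Longrightarrow>
      norm (\<Phi> t t\<^sub>0 x v) \<le> G * exp (\<omega> * (t - s)) * norm (\<Phi> s t\<^sub>0 x v)"
    using growth unfolding uniform_exponential_growth_def T_set_def by auto
  \<comment> \<open>The contraction holds at the integer $[t_0]+K$, less than one time unit before $t_0+K$;
    the factor $c$ compensates the growth over that unit.\<close>
  define c where "c = exp (-1) / (G * exp \<omega>)"
  have c: "0 < c"
    using G by (simp add: c_def)
  obtain K where K: "K \<ge> 1"
    and contr: "\<And>x v t\<^sub>0. 0 \<le> t\<^sub>0 \<Longrightarrow> norm (\<Phi> (real (nat \<lfloor>t\<^sub>0\<rfloor> + K)) t\<^sub>0 x v) \<le> c * norm v"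
    using contraction_at_integer_times[OF coc R M bound c] by blast
  show ?thesis
  proof (rule stable_if_contracting_step[OF coc growth])
    show "real K > 0"
      using K by simp
    fix t\<^sub>0 :: real and x v
    assume t0: "0 \<le> t\<^sub>0"
    define n where "n = real (nat \<lfloor>t\<^sub>0\<rfloor> + K)"
    have n: "t\<^sub>0 \<le> n" "n \<le> t\<^sub>0 + real K" "t\<^sub>0 + real K - n \<le> 1"
      using t0 K unfolding n_def of_nat_add by linarith+
    have "norm (\<Phi> (t\<^sub>0 + real K) t\<^sub>0 x v)
        \<le> G * exp (\<omega> * (t\<^sub>0 + real K - n)) * norm (\<Phi> n t\<^sub>0 x v)"
      using grow t0 n by blast
    also have "\<dots> \<le> G * exp \<omega> * (c * norm v)"
      using contr[OF t0] n G \<omega> by (intro mult_mono) (auto simp: n_def)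
    also have "\<dots> = exp (-1) * norm v"
      using G by (simp add: c_def)
    finally show "norm (\<Phi> (t\<^sub>0 + real K) t\<^sub>0 x v) \<le> exp (-1) * norm v" .
  qed
qed

section \<open>The characterization of stability\<close>

theorem theorem3p5:
  fixes \<phi> :: "real \<Rightarrow> real \<Rightarrow> 'x::metric_space \<Rightarrow> 'x"
    and \<Phi> :: "real \<Rightarrow> real \<Rightarrow> 'x \<Rightarrow> 'v::banach \<Rightarrow>\<^sub>L 'v"
    and C :: "real \<Rightarrow> real \<Rightarrow> 'x \<times> 'v \<Rightarrow> 'x \<times> 'v"
  assumes "skew_evolution_semiflow \<phi> \<Phi> C"
    and "uniform_exponential_growth \<Phi>"
  shows "uniformly_exponentially_stable \<Phi> \<longleftrightarrow>
    (\<exists>R\<in>R_class. \<exists>M::real. M \<ge> 1 \<and>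
      (\<forall>x v. \<forall>t\<^sub>0\<ge>0.
        (\<lambda>n. R (norm (\<Phi> (real n) t\<^sub>0 x v))) summable_on {nat \<lfloor>t\<^sub>0\<rfloor> + 1..} \<and>
        (\<Sum>\<^sub>\<infinity>n\<in>{nat \<lfloor>t\<^sub>0\<rfloor> + 1..}. R (norm (\<Phi> (real n) t\<^sub>0 x v))) \<le> M * R (norm v)))"
proof -
  have coc: "evolution_cocycle \<phi> \<Phi>"
    using assms(1) unfolding skew_evolution_semiflow_def by blast
  have "\<exists>R\<in>R_class. \<exists>M\<ge>1. summability_bound R M \<Phi>" if stable: "uniformly_exponentially_stable \<Phi>"
  proof -
    have "(\<lambda>t. t) \<in> R_class"
      by (auto simp: R_class_def mono_on_def)
    moreover obtain M where "M \<ge> 1" "summability_bound (\<lambda>t. t) M \<Phi>"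
      using stable_imp_summable_norm[OF coc stable] unfolding summability_bound_def by metis
    ultimately show ?thesis
      by blast
  qed
  then have "uniformly_exponentially_stable \<Phi> \<longleftrightarrow>
      (\<exists>R\<in>R_class. \<exists>M. M \<ge> 1 \<and> summability_bound R M \<Phi>)"
    using stable_if_summable[OF coc assms(2)] by blast
  then show ?thesis
    unfolding summability_bound_def .
qed

end
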